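(* Suppose there exist constants $\underline{w}>0$ and $\bar{w}>0$ such that $\underline{w}\le \hat{w}(c,z)\le \bar{w}$ for all $(c,z)$. Let $\hat{\mathcal{Q}}$ denote the distribution with density function $$\hat q(c,z)=\frac{\hat w(c,z)\,p(c,z)}{\int \hat w(c',z')\,p(c',z')\,\mathrm{d}z'\,\mathrm{d}c'}.$$ Then the uncertainty set $\mathcal{U}_\alpha(z)=[\hat f(z)-\eta\hat h(z),\ \hat f(z)+\eta\hat h(z)]$ generated by Algorithm OOD-RO (described in the context) satisfies $$\Big|\mathbb{P}\big(c_{\mathrm{new}}\in\mathcal{U}_\alpha(z_{\mathrm{new}})\big)-\alpha\Big|\le \frac{1}{|\mathcal{D}_2|+1}\cdot\frac{\bar{w}}{\underline{w}}+D_{\mathrm{TV}}(\mathcal{Q},\hat{\mathcal{Q}}),$$ where the probability is with respect to $(c_{\mathrm{new}},z_{\mathrm{new}})\sim\mathcal{Q}$ and $\mathcal{D}_2\sim\mathcal{P}$ (the points of $\mathcal{D}_2$ are i.i.d. from $\mathcal{P}$ and independent of $(c_{\mathrm{new}},z_{\mathrm{new}})$), and $D_{\mathrm{TV}}(\cdot,\cdot)$ denotes the total variation distance between two distributions.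
   Context: Setting. $\mathcal{P}$ (training distribution) and $\mathcal{Q}$ (test distribution) are probability distributions of pairs $(c,z)\in\mathbb{R}^n\times\mathbb{R}^d$, where $c$ is an objective vector and $z$ a covariate vector. All distributions (joint, marginal, conditional) are assumed to have density functions with respect to Lebesgue measure; $p(c,z)$ and $q(c,z)$ denote the joint densities of $\mathcal{P}$ and $\mathcal{Q}$. The true density ratio $w(c,z)=q(c,z)/p(c,z)$ is assumed well-defined everywhere; $\hat w$ is an estimate of it, not assumed accurate. The target level is $\alpha\in(0,1)$. The total variation distance is $D_{\mathrm{TV}}(\mu,\nu)=\sup_A|\mu(A)-\nu(A)|$, the supremum being over measurable sets $A$. Algorithm OOD-RO (box uncertainty set). Inputs: training data $\mathcal{D}_{\mathrm{Tr}}$ consisting of i.i.d. samples $(c_i,z_i)$ from $\mathcal{P}$; a prediction model $\hat f:\mathbb{R}^d\to\mathbb{R}^n$ (for $\mathbb{E}[c|z]$); a density ratio estimate $\hat w(c,z)$; the level $\alpha$. 1. Randomly split $\mathcal{D}_{\mathrm{Tr}}=\mathcal{D}_1\cup\mathcal{D}_2$ with $\mathcal{D}_1\cap\mathcal{D}_2=\emptyset$. 2. For $(c_i,z_i)\in\mathcal{D}_1$ let $r_i=c_i-\hat f(z_i)=(r_{i,1},\dots,r_{i,n})^\top$. Learn a quantile regression model $\hat h:\mathbb{R}^d\to\mathbb{R}^n$ (from any chosen model class) by minimizing $\sum_{(c_i,z_i)\in\mathcal{D}_1}\sum_{k=1}^n\rho_\alpha\big(\hat h(z_i)_k-|r_{i,k}|\big)$,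 where $\rho_\alpha(u)=\alpha\,u^+ +(1-\alpha)\,u^-$, $u^+=\max(u,0)$, $u^-=\max(-u,0)$. No accuracy or structural assumption is made on $\hat f$ or $\hat h$. 3. For $(c_i,z_i)\in\mathcal{D}_2$ let $\bar c_i(\eta)=\hat f(z_i)+\eta\hat h(z_i)$ and $\underline{c}_i(\eta)=\hat f(z_i)-\eta\hat h(z_i)$. Choose the minimal $\eta>0$ such that $$\sum_{(c_i,z_i)\in\mathcal{D}_2}\frac{\hat w(c_i,z_i)\,\mathbf{1}\{\underline{c}_i(\eta)\le c_i\le\bar c_i(\eta)\}}{\sum_{(c_j,z_j)\in\mathcal{D}_2}\hat w(c_j,z_j)}\ \ge\ \alpha,$$ where inequalities between vectors are component-wise. The algorithm presupposes that such a minimal $\eta$ exists (almost surely over $\mathcal{D}_2$). 4. Output $\hat h$ and $\eta$, and for every $z$ the box $\mathcal{U}_\alpha(z)=[\hat f(z)-\eta\hat h(z),\hat f(z)+\eta\hat h(z)]$, i.e. the set of $c\in\mathbb{R}^n$ with $\hat f(z)-\eta\hat h(z)\le c\le\hat f(z)+\eta\hat h(z)$ component-wise. Convention: since the probability is taken only over $\mathcal{D}_2$ and $(c_{\mathrm{new}},z_{\mathrm{new}})$, the functions $\hat f,\hat h,\hat w$ are fixed measurable functions not depending on $\mathcal{D}_2$ or $(c_{\mathrm{new}},z_{\mathrm{new}})$, while $\eta$ is a function of $\mathcal{D}_2$. *)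

theory Defs
  imports "HOL-Probability.Probability"
begin

text \<open>
  A data point is a pair \<open>(c, z)\<close> of an objective vector and a covariate vector. A data set of
  size \<open>N\<close> is a function on \<open>nat\<close> of which only the values at the indices below \<open>N\<close> matter.
\<close>

definition tv_dist :: "'a measure \<Rightarrow> 'a measure \<Rightarrow> real" where
  "tv_dist \<mu> \<nu> = (SUP A\<in>sets \<mu>. \<bar>measure \<mu> A - measure \<nu> A\<bar>)"

definition reweighted :: "('a::euclidean_space \<Rightarrow> real) \<Rightarrow> ('a \<Rightarrow> real) \<Rightarrow> 'a measure" where
  "reweighted w p =
     density lborel (\<lambda>x. ennreal (w x * p x / (\<integral>y. w y * p y \<partial>lborel)))"

definition pinball :: "real \<Rightarrow> real \<Rightarrow> real" where
  "pinball \<alpha> u = \<alpha> * max u 0 + (1 - \<alpha>) * max (- u) 0"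

definition quantile_loss ::
  "real \<Rightarrow> (real ^ 'd \<Rightarrow> real ^ 'n) \<Rightarrow> nat \<Rightarrow> (nat \<Rightarrow> (real ^ 'n) \<times> (real ^ 'd)) \<Rightarrow>
    (real ^ 'd \<Rightarrow> real ^ 'n) \<Rightarrow> real" where
  "quantile_loss \<alpha> f M D h =
     (\<Sum>i<M. \<Sum>k\<in>UNIV.
        pinball \<alpha> (h (snd (D i)) $ k - \<bar>(fst (D i) - f (snd (D i))) $ k\<bar>))"

definition quantile_regression ::
  "real \<Rightarrow> (real ^ 'd \<Rightarrow> real ^ 'n) \<Rightarrow> nat \<Rightarrow> (nat \<Rightarrow> (real ^ 'n) \<times> (real ^ 'd)) \<Rightarrow>
    (real ^ 'd \<Rightarrow> real ^ 'n) set \<Rightarrow> (real ^ 'd \<Rightarrow> real ^ 'n) \<Rightarrow> bool" where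
  "quantile_regression \<alpha> f M D H h \<longleftrightarrow>
     h \<in> H \<and> (\<forall>g\<in>H. quantile_loss \<alpha> f M D h \<le> quantile_loss \<alpha> f M D g)"

text \<open>The order on \<open>real ^ 'n\<close> is component-wise, so this interval is a box; it is empty if some
  component of \<open>\<eta> *\<^sub>R h z\<close> is negative.\<close>

definition box_set ::
  "(real ^ 'd \<Rightarrow> real ^ 'n) \<Rightarrow> (real ^ 'd \<Rightarrow> real ^ 'n) \<Rightarrow> real \<Rightarrow> real ^ 'd \<Rightarrow> (real ^ 'n) set" where
  "box_set f h \<eta> z = {f z - \<eta> *\<^sub>R h z .. f z + \<eta> *\<^sub>R h z}"

definition feasible_scale ::
  "real \<Rightarrow> ((real ^ 'n) \<times> (real ^ 'd) \<Rightarrow> real) \<Rightarrow>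
    (real ^ 'd \<Rightarrow> real ^ 'n) \<Rightarrow> (real ^ 'd \<Rightarrow> real ^ 'n) \<Rightarrow>
    nat \<Rightarrow> (nat \<Rightarrow> (real ^ 'n) \<times> (real ^ 'd)) \<Rightarrow> real \<Rightarrow> bool" where
  "feasible_scale \<alpha> w f h N D \<eta> \<longleftrightarrow>
     0 < \<eta> \<and>
     (\<Sum>i<N. w (D i) * indicator (box_set f h \<eta> (snd (D i))) (fst (D i)) / (\<Sum>j<N. w (D j))) \<ge> \<alpha>"

definition minimal_scale_exists ::
  "real \<Rightarrow> ((real ^ 'n) \<times> (real ^ 'd) \<Rightarrow> real) \<Rightarrow>
    (real ^ 'd \<Rightarrow> real ^ 'n) \<Rightarrow> (real ^ 'd \<Rightarrow> real ^ 'n) \<Rightarrow>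
    nat \<Rightarrow> (nat \<Rightarrow> (real ^ 'n) \<times> (real ^ 'd)) \<Rightarrow> bool" where
  "minimal_scale_exists \<alpha> w f h N D \<longleftrightarrow>
     (\<exists>\<eta>. feasible_scale \<alpha> w f h N D \<eta> \<and> (\<forall>\<eta>'. feasible_scale \<alpha> w f h N D \<eta>' \<longrightarrow> \<eta> \<le> \<eta>'))"

text \<open>Meaningful only if \<^const>\<open>minimal_scale_exists\<close> holds; otherwise it is the same unspecified
  number for all such data sets.\<close>

definition oodro_scale ::
  "real \<Rightarrow> ((real ^ 'n) \<times> (real ^ 'd) \<Rightarrow> real) \<Rightarrow>
    (real ^ 'd \<Rightarrow> real ^ 'n) \<Rightarrow> (real ^ 'd \<Rightarrow> real ^ 'n) \<Rightarrow>
    nat \<Rightarrow> (nat \<Rightarrow> (real ^ 'n) \<times> (real ^ 'd)) \<Rightarrow> real" where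
  "oodro_scale \<alpha> w f h N D = (LEAST \<eta>. feasible_scale \<alpha> w f h N D \<eta>)"

definition oodro_set ::
  "real \<Rightarrow> ((real ^ 'n) \<times> (real ^ 'd) \<Rightarrow> real) \<Rightarrow>
    (real ^ 'd \<Rightarrow> real ^ 'n) \<Rightarrow> (real ^ 'd \<Rightarrow> real ^ 'n) \<Rightarrow>
    nat \<Rightarrow> (nat \<Rightarrow> (real ^ 'n) \<times> (real ^ 'd)) \<Rightarrow> real ^ 'd \<Rightarrow> (real ^ 'n) set" where
  "oodro_set \<alpha> w f h N D z = box_set f h (oodro_scale \<alpha> w f h N D) z"

end

theory Submission
  imports Defs
begin

text \<open>
  The proof is a weighted form of the exchangeability argument for split conformal prediction.

  Give a point \<open>(c, z)\<close> with residual \<open>r = c - f z\<close> the score \<open>max\<^sub>k \<bar>r\<^sub>k\<bar> / h z\<^sub>k\<close>, valued in the extended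
  reals. For \<open>\<eta> > 0\<close> a point lies in the box of scale \<open>\<eta>\<close> iff its score is at most \<open>\<eta>\<close>
  (\<open>in_box_set_iff_score_le\<close>), so the algorithm computes a weighted \<open>\<alpha>\<close>-quantile of the scores.
  Consequently a new point of positive score is covered iff the calibration points of strictly
  smaller score carry less than a fraction \<open>\<alpha>\<close> of the weight of all calibration points (\<open>oodro_set_iff_covered\<close>). This
  condition makes sense for any point \<open>j\<close> of a sample of \<open>N + 1\<close> points when the \<open>N\<close> others are taken
  as the calibration data.

  If the \<open>N + 1\<close> scores are distinct, the points that satisfy the condition have total weight
  within one maximal weight of \<open>\<alpha>\<close> times the total weight (\<open>weighted_rank_sum\<close>). Let all \<open>N + 1\<close> points
  be independent with law \<open>P\<close>. By exchangeability each of them contributes the same amount to the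
  expected covered weight, hence \<open>\<bar>E (w (X\<^sub>j); j is covered) - \<alpha> * E (w (X\<^sub>j))\<bar>\<close> is at most
  \<open>w_hi / (N + 1)\<close> (\<open>expected_covered_weight\<close>). The law \<open>w P / E w\<close> is the reweighted law, so dividing by
  \<open>E w\<close>, which is at least \<open>w_lo\<close>, gives the bound for a new point drawn from the reweighted law
  (\<open>reweighted_coverage\<close>). Replacing this law by \<open>Q\<close> changes the probability of every section of the
  coverage event, hence that of the event itself, by at most the total variation distance
  (\<open>measure_pair_diff_le_tv_dist\<close>).

  Scores are almost surely distinct because they have no atoms. At a finite value this follows from
  absolute continuity: a level set of the score lies in a finite union of sets on which some
  coordinate of \<open>c\<close> is a function of \<open>z\<close>. At infinity it follows from the existence of a minimal
  scale: with positive mass at infinity, all calibration scores would be infinite with positive probability, and then no scale is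
  feasible.
\<close>

section \<open>The score of a data point\<close>

text \<open>The infimum of the positive scales at which one coordinate of the box contains a residual \<open>r\<close> when
  the half-width per unit scale is \<open>h\<close>. The learned width \<open>h\<close> may be zero or negative, in which case the box
  contains \<open>r\<close> at all positive scales or at none; this is why scores live in the extended reals.\<close>

definition scaled_residual :: "real \<Rightarrow> real \<Rightarrow> ereal" where
  "scaled_residual r h = (if 0 < h then ereal (\<bar>r\<bar> / h) else if h = 0 \<and> r = 0 then 0 else \<infinity>)"

definition score ::
  "(real ^ 'd \<Rightarrow> real ^ 'n) \<Rightarrow> (real ^ 'd \<Rightarrow> real ^ 'n) \<Rightarrow> (real ^ 'n) \<times> (real ^ 'd) \<Rightarrow> ereal" where
  "score f h x = (SUP k. scaled_residual ((fst x - f (snd x)) $ k) (h (snd x) $ k))"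

lemma scaled_residual_le_iff:
  assumes "0 < \<eta>"
  shows "scaled_residual r h \<le> ereal \<eta> \<longleftrightarrow> \<bar>r\<bar> \<le> \<eta> * h"
proof (cases "0 < h")
  case True
  then show ?thesis by (simp add: scaled_residual_def divide_simps)
next
  case False
  then have "\<eta> * h = 0 \<and> h = 0 \<or> \<eta> * h < 0 \<and> h < 0"
    using assms by (auto simp: mult_less_0_iff)
  then show ?thesis
    using assms by (auto simp: scaled_residual_def)
qed

lemma in_box_set_iff_score_le:
  assumes "0 < \<eta>"
  shows "fst x \<in> box_set f h \<eta> (snd x) \<longleftrightarrow> score f h x \<le> ereal \<eta>"
proof -
  have "fst x \<in> box_set f h \<eta> (snd x) \<longleftrightarrow>
      (\<forall>k. \<bar>(fst x - f (snd x)) $ k\<bar> \<le> \<eta> * h (snd x) $ k)"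
    by (auto simp: box_set_def less_eq_vec_def abs_le_iff algebra_simps)
  then show ?thesis
    using assms by (simp add: score_def SUP_le_iff scaled_residual_le_iff)
qed

text \<open>A finite score is attained in some coordinate, so a point of score \<open>t\<close> lies on a face of its box
  of scale \<open>t\<close>. This is what makes the level sets of the score Lebesgue null.\<close>

lemma score_eq_finite_imp_face:
  fixes f h :: "real ^ 'd \<Rightarrow> real ^ 'n"
  assumes "score f h x = ereal t"
  shows "\<exists>k. fst x $ k = f (snd x) $ k + t * h (snd x) $ k \<or>
             fst x $ k = f (snd x) $ k - t * h (snd x) $ k"
proof -
  let ?S = "range (\<lambda>k. scaled_residual ((fst x - f (snd x)) $ k) (h (snd x) $ k))"
  have "score f h x \<in> ?S"
    unfolding score_def by (subst Max_Sup[symmetric]) (auto intro!: Max_in)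
  then obtain k where "scaled_residual ((fst x - f (snd x)) $ k) (h (snd x) $ k) = ereal t"
    using assms by auto
  then have "\<bar>(fst x - f (snd x)) $ k\<bar> = t * h (snd x) $ k"
    by (auto simp: scaled_residual_def zero_ereal_def split: if_splits)
  then show ?thesis
    by (intro exI[of _ k]) (auto simp: abs_if split: if_splits)
qed

lemma score_nonneg: "0 \<le> score f h x"
proof -
  have "0 \<le> scaled_residual ((fst x - f (snd x)) $ undefined) (h (snd x) $ undefined)"
    by (simp add: scaled_residual_def)
  also have "\<dots> \<le> score f h x"
    unfolding score_def by (rule SUP_upper) simp
  finally show ?thesis .
qed

lemma borel_measurable_component [measurable]:
  "(\<lambda>y :: real ^ 'n. y $ k) \<in> borel_measurable borel"
  by (intro borel_measurable_continuous_onI continuous_intros)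

lemma borel_measurable_projections [measurable]:
  "fst \<in> (borel :: ('a :: euclidean_space \<times> 'b :: euclidean_space) measure) \<rightarrow>\<^sub>M borel"
  "snd \<in> (borel :: ('a :: euclidean_space \<times> 'b :: euclidean_space) measure) \<rightarrow>\<^sub>M borel"
  by (simp_all add: borel_prod[symmetric])

lemma borel_measurable_score [measurable]:
  fixes f h :: "real ^ 'd \<Rightarrow> real ^ 'n"
  assumes [measurable]: "f \<in> borel_measurable borel" "h \<in> borel_measurable borel"
  shows "score f h \<in> borel_measurable borel"
proof -
  show ?thesis
    unfolding score_def scaled_residual_def by measurable
qed

lemma AE_lborel_component_neq:
  "AE c :: real ^ 'n in lborel. c $ k \<noteq> a"
proof -
  have "{c :: real ^ 'n. c $ k = a} \<in> null_sets lborel"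
    using negligible_standard_hyperplane[of "axis k 1 :: real ^ 'n" a]
    by (subst null_sets_completion_iff[symmetric])
       (auto simp: negligible_iff_null_sets inner_axis axis_in_Basis_iff)
  then show ?thesis
    by (rule AE_I') auto
qed

text \<open>For every fixed \<open>z\<close> the points of the graph above \<open>z\<close> form a hyperplane in the space of \<open>c\<close>; Fubini
  then shows that the graph is a null set.\<close>

lemma AE_lborel_graph_neq:
  fixes g :: "real ^ 'd \<Rightarrow> real"
  assumes [measurable]: "g \<in> borel_measurable borel"
  shows "AE x :: (real ^ 'n) \<times> (real ^ 'd) in lborel. fst x $ k \<noteq> g (snd x)"
proof -
  have "AE z in lborel. AE c :: real ^ 'n in lborel. c $ k \<noteq> g z"
    by (simp add: AE_lborel_component_neq)
  then have "AE c :: real ^ 'n in lborel. AE z in lborel. c $ k \<noteq> g z"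
    by (subst lborel_pair.AE_commute) measurable
  then have "AE x in lborel \<Otimes>\<^sub>M lborel. (fst x :: real ^ 'n) $ k \<noteq> g (snd x)"
  proof (intro lborel_pair.AE_pair_measure)
    show "{x \<in> space (lborel \<Otimes>\<^sub>M lborel). (fst x :: real ^ 'n) $ k \<noteq> g (snd x)}
        \<in> sets (lborel \<Otimes>\<^sub>M lborel)"
      by measurable
  qed simp
  then show ?thesis
    unfolding lborel_prod .
qed

lemma AE_lborel_score_neq:
  fixes f h :: "real ^ 'd \<Rightarrow> real ^ 'n"
  assumes [measurable]: "f \<in> borel_measurable borel" "h \<in> borel_measurable borel"
  shows "AE x in lborel. score f h x \<noteq> ereal t"
proof -
  have "AE x :: (real ^ 'n) \<times> (real ^ 'd) in lborel.
      \<forall>k. fst x $ k \<noteq> f (snd x) $ k + t * h (snd x) $ k"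
    by (subst AE_all_countable) (intro allI AE_lborel_graph_neq; measurable)
  moreover have "AE x :: (real ^ 'n) \<times> (real ^ 'd) in lborel.
      \<forall>k. fst x $ k \<noteq> f (snd x) $ k - t * h (snd x) $ k"
    by (subst AE_all_countable) (intro allI AE_lborel_graph_neq; measurable)
  ultimately show ?thesis
    by eventually_elim (use score_eq_finite_imp_face in blast)
qed

section \<open>Measurability of the calibrated set\<close>

lemma feasible_scale_iff:
  assumes "0 < \<eta>"
  shows "feasible_scale \<alpha> w f h N D \<eta> \<longleftrightarrow>
    \<alpha> \<le> (\<Sum>i<N. if score f h (D i) \<le> ereal \<eta> then w (D i) else 0) / (\<Sum>j<N. w (D j))"
proof -
  have "(\<Sum>i<N. w (D i) * indicator (box_set f h \<eta> (snd (D i))) (fst (D i)) / (\<Sum>j<N. w (D j))) =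
      (\<Sum>i<N. (if score f h (D i) \<le> ereal \<eta> then w (D i) else 0) / (\<Sum>j<N. w (D j)))"
    using assms by (intro sum.cong) (auto simp: in_box_set_iff_score_le indicator_def)
  then show ?thesis
    using assms by (simp add: feasible_scale_def sum_divide_distrib)
qed

lemma feasible_scale_mono:
  assumes w: "\<And>x. 0 \<le> w x" and "feasible_scale \<alpha> w f h N D \<eta>" "\<eta> \<le> \<eta>'"
  shows "feasible_scale \<alpha> w f h N D \<eta>'"
proof -
  have pos: "0 < \<eta>" "0 < \<eta>'"
    using assms by (auto simp: feasible_scale_def)
  have "(\<Sum>i<N. if score f h (D i) \<le> ereal \<eta> then w (D i) else 0)
      \<le> (\<Sum>i<N. if score f h (D i) \<le> ereal \<eta>' then w (D i) else 0)"
    using w assms(3) by (intro sum_mono) (auto dest: order_trans[of _ "ereal \<eta>" "ereal \<eta>'"])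
  then have "(\<Sum>i<N. if score f h (D i) \<le> ereal \<eta> then w (D i) else 0) / (\<Sum>j<N. w (D j))
      \<le> (\<Sum>i<N. if score f h (D i) \<le> ereal \<eta>' then w (D i) else 0) / (\<Sum>j<N. w (D j))"
    using w by (intro divide_right_mono sum_nonneg)
  then show ?thesis
    using assms(2) pos by (simp add: feasible_scale_iff)
qed

text \<open>Only finitely many scores occur, so the set of points covered at scale \<open>\<eta>\<close> does not change on a
  small interval to the right of \<open>\<eta>\<close>.\<close>

lemma feasible_scale_right_closed:
  assumes "0 < \<eta>" and feasible: "\<And>t. \<eta> < t \<Longrightarrow> feasible_scale \<alpha> w f h N D t"
  shows "feasible_scale \<alpha> w f h N D \<eta>"
proof -
  define S where "S = {s \<in> (\<lambda>i. score f h (D i)) ` {..<N}. ereal \<eta> < s}"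
  have "finite S"
    by (simp add: S_def)
  \<comment> \<open>Infinity is inserted because no calibration score need exceed \<open>\<eta>\<close>.\<close>
  then have "ereal \<eta> < Min (insert \<infinity> S)"
    by (subst Min_gr_iff) (auto simp: S_def)
  then obtain t where t: "ereal \<eta> < ereal t" "ereal t < Min (insert \<infinity> S)"
    using ereal_dense2 by blast
  have "score f h (D i) \<le> ereal t \<longleftrightarrow> score f h (D i) \<le> ereal \<eta>" if "i < N" for i
  proof
    assume le: "score f h (D i) \<le> ereal t"
    show "score f h (D i) \<le> ereal \<eta>"
    proof (rule ccontr)
      assume "\<not> score f h (D i) \<le> ereal \<eta>"
      then have "score f h (D i) \<in> S"
        using that by (auto simp: S_def)
      then show False
        using le t(2) \<open>finite S\<close> by (auto simp: Min_gr_iff)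
    qed
  next
    assume "score f h (D i) \<le> ereal \<eta>"
    then show "score f h (D i) \<le> ereal t"
      using t(1) by (metis less_imp_le order_trans)
  qed
  then have "(\<Sum>i<N. if score f h (D i) \<le> ereal t then w (D i) else 0) =
      (\<Sum>i<N. if score f h (D i) \<le> ereal \<eta> then w (D i) else 0)"
    by (intro sum.cong) auto
  then show ?thesis
    using feasible[of t] t(1) assms(1) by (simp add: feasible_scale_iff)
qed

text \<open>The set of feasible scales is closed upwards, and it contains its infimum if that is positive. A
  minimum is therefore missing only if this set is empty or consists of all positive reals, and
  countably many scales decide whether one of the two cases occurs.\<close>

lemma minimal_scale_exists_iff:
  assumes w: "\<And>x. 0 \<le> w x"
  shows "minimal_scale_exists \<alpha> w f h N D \<longleftrightarrow>
    (\<exists>n. feasible_scale \<alpha> w f h N D (real (Suc n))) \<and>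
    (\<exists>n. \<not> feasible_scale \<alpha> w f h N D (1 / real (Suc n)))"
proof
  assume "minimal_scale_exists \<alpha> w f h N D"
  then obtain \<eta> where \<eta>: "feasible_scale \<alpha> w f h N D \<eta>"
      "\<And>\<eta>'. feasible_scale \<alpha> w f h N D \<eta>' \<Longrightarrow> \<eta> \<le> \<eta>'"
    by (auto simp: minimal_scale_exists_def)
  then have "0 < \<eta>"
    by (simp add: feasible_scale_def)
  then obtain n m where "\<eta> < real n" "1 / real (Suc m) < \<eta>"
    by (metis reals_Archimedean2 reals_Archimedean inverse_eq_divide)
  then have "feasible_scale \<alpha> w f h N D (real (Suc n))"
      "\<not> feasible_scale \<alpha> w f h N D (1 / real (Suc m))"
    using feasible_scale_mono[where w=w, OF w \<eta>(1), of "real (Suc n)"] \<eta>(2)[of "1 / real (Suc m)"]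
    by auto
  then show "(\<exists>n. feasible_scale \<alpha> w f h N D (real (Suc n))) \<and>
      (\<exists>n. \<not> feasible_scale \<alpha> w f h N D (1 / real (Suc n)))"
    by blast
next
  let ?F = "{t. feasible_scale \<alpha> w f h N D t}"
  assume "(\<exists>n. feasible_scale \<alpha> w f h N D (real (Suc n))) \<and>
      (\<exists>n. \<not> feasible_scale \<alpha> w f h N D (1 / real (Suc n)))"
  then obtain n m where n: "feasible_scale \<alpha> w f h N D (real (Suc n))"
      and m: "\<not> feasible_scale \<alpha> w f h N D (1 / real (Suc m))"
    by blast
  have lower: "1 / real (Suc m) \<le> t" if "t \<in> ?F" for t
    using feasible_scale_mono[where w=w, OF w, of \<alpha> f h N D t "1 / real (Suc m)"] that m by force
  then have bdd: "bdd_below ?F"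
    by (auto simp: bdd_below_def)
  have "1 / real (Suc m) \<le> Inf ?F"
    using n lower by (intro cInf_greatest) auto
  moreover have "0 < 1 / real (Suc m)"
    by simp
  ultimately have "0 < Inf ?F"
    by linarith
  moreover have "feasible_scale \<alpha> w f h N D t" if t: "Inf ?F < t" for t
  proof -
    obtain u where "u \<in> ?F" "u < t"
      using t n bdd by (metis (mono_tags, lifting) cInf_lessD empty_iff mem_Collect_eq)
    then show ?thesis
      using feasible_scale_mono[where w=w, OF w, of \<alpha> f h N D u t] by simp
  qed
  ultimately have "feasible_scale \<alpha> w f h N D (Inf ?F)"
    by (rule feasible_scale_right_closed)
  then show "minimal_scale_exists \<alpha> w f h N D"
    unfolding minimal_scale_exists_def using cInf_lower[OF _ bdd]
    by (intro exI[of _ "Inf ?F"]) simp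
qed

lemma oodro_scale_minimal:
  assumes "minimal_scale_exists \<alpha> w f h N D"
  shows "feasible_scale \<alpha> w f h N D (oodro_scale \<alpha> w f h N D)"
    and "feasible_scale \<alpha> w f h N D t \<Longrightarrow> oodro_scale \<alpha> w f h N D \<le> t"
proof -
  obtain \<eta> where \<eta>: "feasible_scale \<alpha> w f h N D \<eta>"
      "\<And>\<eta>'. feasible_scale \<alpha> w f h N D \<eta>' \<Longrightarrow> \<eta> \<le> \<eta>'"
    using assms by (auto simp: minimal_scale_exists_def)
  then have "oodro_scale \<alpha> w f h N D = \<eta>"
    unfolding oodro_scale_def by (intro Least_equality)
  with \<eta> show "feasible_scale \<alpha> w f h N D (oodro_scale \<alpha> w f h N D)"
    and "feasible_scale \<alpha> w f h N D t \<Longrightarrow> oodro_scale \<alpha> w f h N D \<le> t"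
    by auto
qed

text \<open>Where no minimum exists the scale is one and the same unspecified real, and so it is still a
  measurable function of the data there.\<close>

lemma oodro_scale_default:
  assumes "\<not> minimal_scale_exists \<alpha> w f h N D"
  shows "oodro_scale \<alpha> w f h N D = (LEAST \<eta>. False)"
proof -
  have "(\<lambda>\<eta>. feasible_scale \<alpha> w f h N D \<eta> \<and> (\<forall>\<eta>'. feasible_scale \<alpha> w f h N D \<eta>' \<longrightarrow> \<eta> \<le> \<eta>')) =
      (\<lambda>\<eta>. False \<and> (\<forall>\<eta>'. False \<longrightarrow> \<eta> \<le> \<eta>'))"
    using assms by (intro ext) (simp add: minimal_scale_exists_def)
  then show ?thesis
    unfolding oodro_scale_def Least_def by (rule arg_cong)
qed

lemma measurable_oodro_scale:
  fixes f h :: "real ^ 'd \<Rightarrow> real ^ 'n"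
  assumes w: "\<And>x. 0 \<le> w x" and [measurable]: "w \<in> borel_measurable borel"
    and [measurable]: "f \<in> borel_measurable borel" "h \<in> borel_measurable borel"
    and P [measurable_cong]: "sets P = sets borel"
  shows "oodro_scale \<alpha> w f h N \<in> borel_measurable (PiM {..<N} (\<lambda>_. P))"
proof -
  let ?M = "PiM {..<N} (\<lambda>_. P)"
  have feas: "Measurable.pred ?M (\<lambda>D. feasible_scale \<alpha> w f h N D t)" for t
  proof (cases "0 < t")
    case True
    then show ?thesis
      by (simp add: feasible_scale_iff)
  next
    case False
    then show ?thesis
      by (simp add: feasible_scale_def)
  qed
  note [measurable] = feas
  have ex [measurable]: "Measurable.pred ?M (\<lambda>D. minimal_scale_exists \<alpha> w f h N D)"
    unfolding minimal_scale_exists_iff[OF w] by measurable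
  have "Measurable.pred ?M (\<lambda>D. oodro_scale \<alpha> w f h N D \<le> t)" for t
  proof -
    have "oodro_scale \<alpha> w f h N D \<le> t \<longleftrightarrow>
        (if minimal_scale_exists \<alpha> w f h N D then feasible_scale \<alpha> w f h N D t
         else (LEAST \<eta>. False) \<le> t)" for D
    proof (cases "minimal_scale_exists \<alpha> w f h N D")
      case True
      then show ?thesis
        using oodro_scale_minimal[OF True]
          feasible_scale_mono[where w=w, OF w, of \<alpha> f h N D "oodro_scale \<alpha> w f h N D" t]
        by auto
    qed (simp add: oodro_scale_default)
    then show ?thesis
      by simp
  qed
  then show ?thesis
    unfolding borel_measurable_iff_le by (auto simp: pred_def)
qed

text \<open>The coverage event has to be measurable on the nose, also on the null set of data sets
  without a minimal scale: the measure of a set that is not measurable is zero by convention.\<close>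

lemma measurable_oodro_coverage:
  fixes f h :: "real ^ 'd \<Rightarrow> real ^ 'n"
  assumes w: "\<And>x. 0 \<le> w x" "w \<in> borel_measurable borel"
    and [measurable]: "f \<in> borel_measurable borel" "h \<in> borel_measurable borel"
    and P: "sets P = sets borel" and R: "sets R = sets borel"
  shows "{\<omega> \<in> space (PiM {..<N} (\<lambda>_. P) \<Otimes>\<^sub>M R).
      fst (snd \<omega>) \<in> oodro_set \<alpha> w f h N (fst \<omega>) (snd (snd \<omega>))} \<in> sets (PiM {..<N} (\<lambda>_. P) \<Otimes>\<^sub>M R)"
proof -
  let ?M = "PiM {..<N} (\<lambda>_. P) \<Otimes>\<^sub>M R"
  note [measurable_cong] = R
  have [measurable]: "oodro_scale \<alpha> w f h N \<in> borel_measurable (PiM {..<N} (\<lambda>_. P))"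
    using w P by (intro measurable_oodro_scale) auto
  have "{\<omega> \<in> space ?M. fst (snd \<omega>) \<in> oodro_set \<alpha> w f h N (fst \<omega>) (snd (snd \<omega>))} =
    {\<omega> \<in> space ?M. \<forall>k.
       (f (snd (snd \<omega>)) - oodro_scale \<alpha> w f h N (fst \<omega>) *\<^sub>R h (snd (snd \<omega>))) $ k \<le> fst (snd \<omega>) $ k \<and>
       fst (snd \<omega>) $ k \<le> (f (snd (snd \<omega>)) + oodro_scale \<alpha> w f h N (fst \<omega>) *\<^sub>R h (snd (snd \<omega>))) $ k}"
    unfolding oodro_set_def box_set_def atLeastAtMost_iff less_eq_vec_def by blast
  also have "\<dots> \<in> sets ?M"
    by measurable
  finally show ?thesis .
qed

section \<open>Coverage as a rank condition\<close>

text \<open>The rank condition for the point with index \<open>j\<close> relative to the others: those of strictly smaller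
  score carry less than a fraction \<open>\<alpha>\<close> of the weight of the points other than \<open>j\<close>. All points of the
  sample enter on the same footing, which the argument from exchangeability needs.\<close>

definition covered ::
  "real \<Rightarrow> ('a \<Rightarrow> real) \<Rightarrow> ('a \<Rightarrow> ereal) \<Rightarrow> 'i set \<Rightarrow> ('i \<Rightarrow> 'a) \<Rightarrow> 'i \<Rightarrow> bool" where
  "covered \<alpha> w s I X j \<longleftrightarrow>
     (\<Sum>i\<in>I. if s (X i) < s (X j) then w (X i) else 0) < \<alpha> * (\<Sum>i\<in>I - {j}. w (X i))"

text \<open>A weighted \<open>\<alpha>\<close>-quantile of the calibration scores is at least \<open>score f h x\<close> iff every smaller positive scale
  fails to collect a fraction \<open>\<alpha>\<close> of the weight, that is, iff the scores strictly below
  \<open>score f h x\<close> fail to. A positive score is needed because only positive scales are admitted.\<close>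

lemma oodro_set_iff_covered:
  assumes w: "\<And>x. 0 < w x" and ex: "minimal_scale_exists \<alpha> w f h N D" and "0 < \<alpha>"
    and pos: "0 < score f h x"
  shows "fst x \<in> oodro_set \<alpha> w f h N D (snd x) \<longleftrightarrow>
    covered \<alpha> w (score f h) {..<Suc N} (D(N := x)) N"
proof -
  define \<eta> where "\<eta> = oodro_scale \<alpha> w f h N D"
  let ?s = "score f h" and ?W = "\<Sum>j<N. w (D j)"
  have feas: "feasible_scale \<alpha> w f h N D \<eta>"
    and least: "\<And>t. feasible_scale \<alpha> w f h N D t \<Longrightarrow> \<eta> \<le> t"
    using oodro_scale_minimal[OF ex] by (auto simp: \<eta>_def)
  then have "0 < \<eta>"
    by (simp add: feasible_scale_def)
  have "N \<noteq> 0"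
  proof
    assume "N = 0"
    with feas \<open>0 < \<alpha>\<close> show False by (simp add: feasible_scale_def)
  qed
  then have W: "0 < ?W"
    using w by (intro sum_pos) auto
  have feas_iff: "feasible_scale \<alpha> w f h N D t \<longleftrightarrow>
      \<alpha> * ?W \<le> (\<Sum>i<N. if ?s (D i) \<le> ereal t then w (D i) else 0)" if "0 < t" for t
    using W that by (simp add: feasible_scale_iff pos_le_divide_eq)
  have cov: "covered \<alpha> w ?s {..<Suc N} (D(N := x)) N \<longleftrightarrow>
      (\<Sum>i<N. if ?s (D i) < ?s x then w (D i) else 0) < \<alpha> * ?W"
  proof -
    have "{..<Suc N} - {N} = {..<N}"
      by auto
    moreover have "(\<Sum>i<N. if ?s (D i) < ?s x then w ((D(N := x)) i) else 0) =
        (\<Sum>i<N. if ?s (D i) < ?s x then w (D i) else 0)"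
      by (intro sum.cong) auto
    ultimately show ?thesis
      by (simp add: covered_def)
  qed
  have "fst x \<in> oodro_set \<alpha> w f h N D (snd x) \<longleftrightarrow> ?s x \<le> ereal \<eta>"
    using \<open>0 < \<eta>\<close> by (simp add: oodro_set_def \<eta>_def[symmetric] in_box_set_iff_score_le)
  also have "\<dots> \<longleftrightarrow> (\<Sum>i<N. if ?s (D i) < ?s x then w (D i) else 0) < \<alpha> * ?W"
  proof
    assume le: "?s x \<le> ereal \<eta>"
    \<comment> \<open>A positive scale \<open>t\<close> strictly between the scores below that of \<open>x\<close> and that of \<open>x\<close> collects all of the former.\<close>
    let ?T = "insert 0 {s \<in> (\<lambda>i. ?s (D i)) ` {..<N}. s < ?s x}"
    have "Max ?T < ?s x"
      using pos by (subst Max_less_iff) auto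
    then obtain t where t: "Max ?T < ereal t" "ereal t < ?s x"
      using ereal_dense2 by blast
    have "0 \<le> Max ?T"
      by (rule Max_ge) auto
    then have "0 < ereal t"
      using t(1) by (rule order.strict_trans1)
    then have "0 < t"
      by simp
    have "?s (D i) \<le> ereal t" if "i < N" "?s (D i) < ?s x" for i
    proof -
      have "?s (D i) \<le> Max ?T"
        using that by (intro Max_ge) auto
      then show ?thesis
        using t(1) by (meson le_less_trans less_imp_le)
    qed
    then have "(\<Sum>i<N. if ?s (D i) < ?s x then w (D i) else 0)
        \<le> (\<Sum>i<N. if ?s (D i) \<le> ereal t then w (D i) else 0)"
      using w by (intro sum_mono) (auto simp: less_imp_le)
    moreover have "t < \<eta>"
      using t(2) le by (metis less_ereal.simps(1) order_less_le_trans)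
    then have "\<not> feasible_scale \<alpha> w f h N D t"
      using least by force
    ultimately show "(\<Sum>i<N. if ?s (D i) < ?s x then w (D i) else 0) < \<alpha> * ?W"
      using feas_iff[OF \<open>0 < t\<close>] by simp
  next
    assume less: "(\<Sum>i<N. if ?s (D i) < ?s x then w (D i) else 0) < \<alpha> * ?W"
    show "?s x \<le> ereal \<eta>"
    proof (rule ccontr)
      assume "\<not> ?s x \<le> ereal \<eta>"
      then have "(\<Sum>i<N. if ?s (D i) \<le> ereal \<eta> then w (D i) else 0)
          \<le> (\<Sum>i<N. if ?s (D i) < ?s x then w (D i) else 0)"
        using w by (intro sum_mono) (auto simp: less_imp_le)
      then show False
        using less feas feas_iff[OF \<open>0 < \<eta>\<close>] by simp
    qed
  qed
  finally show ?thesis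
    by (simp add: cov)
qed

text \<open>If infinity were an atom of the score, all calibration scores would be infinite with positive
  probability, and no scale would then be feasible. For \<open>N = 0\<close> the argument still applies, as the
  existence assumption is then contradictory.\<close>

lemma AE_score_finite:
  fixes f h :: "real ^ 'd \<Rightarrow> real ^ 'n"
  assumes P: "prob_space P" and "0 < \<alpha>" and [measurable]: "score f h \<in> borel_measurable P"
    and ex: "AE D in PiM {..<N} (\<lambda>_. P). minimal_scale_exists \<alpha> w f h N D"
  shows "AE x in P. score f h x \<noteq> \<infinity>"
proof -
  interpret P: prob_space P by fact
  interpret product_sigma_finite "\<lambda>_. P" by standard
  define A where "A = {x \<in> space P. score f h x = \<infinity>}"
  have A [measurable]: "A \<in> sets P"
    unfolding A_def by measurable
  have "D \<notin> Pi\<^sub>E {..<N} (\<lambda>_. A)" if D: "minimal_scale_exists \<alpha> w f h N D" for D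
  proof
    assume "D \<in> Pi\<^sub>E {..<N} (\<lambda>_. A)"
    then have inf: "score f h (D i) = \<infinity>" if "i < N" for i
      using that by (auto simp: A_def dest: PiE_mem)
    obtain \<eta> where \<eta>: "feasible_scale \<alpha> w f h N D \<eta>"
      using D by (auto simp: minimal_scale_exists_def)
    then have "0 < \<eta>"
      by (simp add: feasible_scale_def)
    have "(\<Sum>i<N. if score f h (D i) \<le> ereal \<eta> then w (D i) else 0) = 0"
      by (intro sum.neutral) (auto simp: inf)
    then show False
      using \<eta> \<open>0 < \<alpha>\<close> by (simp add: feasible_scale_iff[OF \<open>0 < \<eta>\<close>])
  qed
  then have "AE D in PiM {..<N} (\<lambda>_. P). D \<notin> Pi\<^sub>E {..<N} (\<lambda>_. A)"
    using ex by (auto elim: eventually_mono)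
  then have "emeasure (PiM {..<N} (\<lambda>_. P)) (Pi\<^sub>E {..<N} (\<lambda>_. A)) = 0"
    by (subst (asm) AE_iff_null_sets[symmetric]) (auto intro!: sets_PiM_I_finite)
  then have "emeasure P A = 0"
    by (simp add: emeasure_PiM power_eq_0_iff split: if_splits)
  then show ?thesis
    by (intro AE_I[of _ _ A]) (auto simp: A_def)
qed

text \<open>The selected indices are an initial segment in the order of scores, cut where the cumulative weight
  crosses \<open>\<alpha>\<close> times the total. The index of largest score inside \<open>J\<close> bounds the weight of \<open>J\<close> from above,
  the index of smallest score outside \<open>J\<close> bounds it from below, and either estimate is off by at most
  the weight of the single index used.\<close>

lemma weighted_rank_sum:
  fixes s :: "'i \<Rightarrow> 'a :: linorder" and w :: "'i \<Rightarrow> real"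
  assumes I: "finite I" "inj_on s I"
    and w: "\<And>i. i \<in> I \<Longrightarrow> 0 \<le> w i" "\<And>i. i \<in> I \<Longrightarrow> w i \<le> b" and b: "0 \<le> b"
    and \<alpha>: "0 \<le> \<alpha>" "\<alpha> \<le> 1"
  defines "J \<equiv> {j \<in> I. (\<Sum>i\<in>I. if s i < s j then w i else 0) < \<alpha> * (\<Sum>i\<in>I - {j}. w i)}"
  shows "\<bar>sum w J - \<alpha> * sum w I\<bar> \<le> b"
proof -
  have eq: "(\<Sum>i\<in>I. if s i < s j then w i else 0) = sum w {i \<in> I. s i < s j}" for j
    using I(1) by (simp add: sum.inter_filter)
  have rest: "(\<Sum>i\<in>I - {j}. w i) = sum w I - w j" if "j \<in> I" for j
    using that I(1) by (simp add: sum_diff1)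
  have weight: "(1 - \<alpha>) * w j \<le> b" "\<alpha> * w j \<le> b" if "j \<in> I" for j
    using w[OF that] \<alpha> by (auto intro: order_trans[OF mult_left_le_one_le])
  have fin: "finite J" "J \<subseteq> I"
    using I(1) by (auto simp: J_def)
  have "sum w J - \<alpha> * sum w I \<le> b"
  proof (cases "J = {}")
    case True
    then show ?thesis
      using w \<alpha> b mult_nonneg_nonneg[OF \<alpha>(1) sum_nonneg[of I w]] by simp
  next
    case False
    then have "Max (s ` J) \<in> s ` J"
      using fin(1) by simp
    then obtain k where "k \<in> J" "s k = Max (s ` J)"
      by auto
    with fin(1) have k: "k \<in> J" "\<And>i. i \<in> J \<Longrightarrow> s i \<le> s k"
      by simp_all
    have "J \<subseteq> insert k {i \<in> I. s i < s k}"
    proof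
      fix i assume "i \<in> J"
      with k fin(2) have "s i \<le> s k" "s i = s k \<Longrightarrow> i = k" "i \<in> I"
        using inj_onD[OF I(2)] by blast+
      then show "i \<in> insert k {i \<in> I. s i < s k}"
        by (auto simp: less_le)
    qed
    then have "sum w J \<le> sum w (insert k {i \<in> I. s i < s k})"
      using I(1) w k(1) fin(2) by (intro sum_mono2) auto
    also have "\<dots> = w k + sum w {i \<in> I. s i < s k}"
      using I(1) by simp
    also have "\<dots> \<le> w k + \<alpha> * (sum w I - w k)"
      using k(1) rest[of k] by (simp add: J_def eq)
    finally show ?thesis
      using weight(1)[of k] k(1) fin(2) by (auto simp: algebra_simps)
  qed
  moreover have "\<alpha> * sum w I - sum w J \<le> b"
  proof (cases "J = I")
    case True
    have "\<alpha> * sum w I \<le> 1 * sum w I"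
      using \<alpha> w by (intro mult_right_mono) (auto intro: sum_nonneg)
    then show ?thesis using True b by simp
  next
    case False
    then have "s ` (I - J) \<noteq> {}" using fin(2) by auto
    then have "Min (s ` (I - J)) \<in> s ` (I - J)"
      using I(1) by (intro Min_in) simp_all
    then obtain m where "m \<in> I - J" "s m = Min (s ` (I - J))"
      by auto
    with I(1) have m: "m \<in> I - J" "\<And>i. i \<in> I - J \<Longrightarrow> s m \<le> s i"
      by simp_all
    have "\<alpha> * (sum w I - w m) \<le> sum w {i \<in> I. s i < s m}"
      using m(1) rest[of m] by (simp add: J_def eq not_less)
    also have "\<dots> \<le> sum w J"
      using fin w m(2) by (intro sum_mono2) (auto simp: not_le[symmetric])
    finally show ?thesis
      using weight(2)[of m] m(1) by (auto simp: algebra_simps)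
  qed
  ultimately show ?thesis by linarith
qed

section \<open>Exchangeability\<close>

lemma measurable_covered [measurable]:
  assumes "finite I" "j \<in> I" and [measurable]: "w \<in> borel_measurable P" "s \<in> borel_measurable P"
  shows "Measurable.pred (PiM I (\<lambda>_. P)) (\<lambda>X. covered \<alpha> w s I X j)"
  using assms(1,2) unfolding covered_def by measurable

text \<open>Exchangeability of an independent and identically distributed sample, in the form of invariance
  under swapping two coordinates.\<close>

lemma integral_PiM_transpose:
  fixes F :: "('i \<Rightarrow> 'a) \<Rightarrow> real"
  assumes "prob_space P" "j \<in> I" "k \<in> I"
    and F: "F \<in> borel_measurable (PiM I (\<lambda>_. P))"
  shows "(\<integral>X. F (\<lambda>i\<in>I. X (Transposition.transpose j k i)) \<partial>PiM I (\<lambda>_. P)) =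
    (\<integral>X. F X \<partial>PiM I (\<lambda>_. P))"
proof -
  let ?\<tau> = "Transposition.transpose j k" and ?M = "PiM I (\<lambda>_. P)"
  have \<tau>: "?\<tau> \<in> I \<rightarrow> I"
    using assms(2,3) by (auto simp: Transposition.transpose_def)
  have distr: "distr ?M ?M (\<lambda>X. \<lambda>i\<in>I. X (?\<tau> i)) = ?M"
    using distr_PiM_reindex[of I "\<lambda>_. P" ?\<tau> I] assms(1) \<tau> by simp
  have "(\<lambda>X. \<lambda>i\<in>I. X (?\<tau> i)) \<in> ?M \<rightarrow>\<^sub>M ?M"
    using \<tau> by (intro measurable_restrict measurable_component_singleton) auto
  from integral_distr[OF this F] show ?thesis
    by (simp add: distr)
qed

lemma covered_transpose:
  assumes "finite I" "j \<in> I" "k \<in> I"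
  shows "covered \<alpha> w s I (\<lambda>i\<in>I. X (Transposition.transpose j k i)) j \<longleftrightarrow> covered \<alpha> w s I X k"
proof -
  let ?\<tau> = "Transposition.transpose j k"
  define Y where "Y = (\<lambda>i\<in>I. X (?\<tau> i))"
  have Y: "Y i = X (?\<tau> i)" if "i \<in> I" for i
    using that by (simp add: Y_def)
  have image: "?\<tau> ` I = I" "?\<tau> ` (I - {j}) = I - {k}"
    using assms(2,3) by (auto simp: image_set_diff[OF inj_transpose])
  have "(\<Sum>i\<in>I. if s (Y i) < s (Y j) then w (Y i) else 0) =
      (\<Sum>i\<in>I. if s (X (?\<tau> i)) < s (X k) then w (X (?\<tau> i)) else 0)"
    using assms(2) by (intro sum.cong) (auto simp: Y)
  also have "\<dots> = (\<Sum>i\<in>?\<tau> ` I. if s (X i) < s (X k) then w (X i) else 0)"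
    by (simp add: sum.reindex del: transpose_image_eq)
  finally have lower: "(\<Sum>i\<in>I. if s (Y i) < s (Y j) then w (Y i) else 0) =
      (\<Sum>i\<in>I. if s (X i) < s (X k) then w (X i) else 0)"
    by (simp only: image)
  have "(\<Sum>i\<in>I - {j}. w (Y i)) = (\<Sum>i\<in>I - {j}. w (X (?\<tau> i)))"
    by (intro sum.cong) (auto simp: Y)
  also have "\<dots> = (\<Sum>i\<in>?\<tau> ` (I - {j}). w (X i))"
    by (simp add: sum.reindex del: transpose_image_eq)
  finally have "(\<Sum>i\<in>I - {j}. w (Y i)) = (\<Sum>i\<in>I - {k}. w (X i))"
    by (simp only: image)
  with lower show ?thesis
    by (simp add: covered_def Y_def[symmetric])
qed

text \<open>Two coordinates are independent: conditionally on the second one, the first avoids the given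
  score almost surely since the score has no atoms.\<close>

lemma AE_PiM_inj_on:
  assumes "prob_space P" "finite I" and [measurable]: "s \<in> borel_measurable P"
    and atomless: "\<And>t :: ereal. AE x in P. s x \<noteq> t"
  shows "AE X in PiM I (\<lambda>_. P). inj_on (\<lambda>i. s (X i)) I"
proof -
  interpret P: prob_space P by fact
  interpret product_sigma_finite "\<lambda>_. P" by standard
  have neq: "AE X in PiM I (\<lambda>_. P). s (X i) \<noteq> s (X j)" if ij: "i \<in> I" "j \<in> I" "i \<noteq> j" for i j
  proof -
    have I: "I = insert i (I - {i})" and fin: "finite (I - {i})"
      using ij assms(2) by auto
    have [measurable]: "{X \<in> space (PiM I (\<lambda>_. P)). s (X i) = s (X j)} \<in> sets (PiM I (\<lambda>_. P))"
      using ij by measurable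
    have "emeasure (PiM I (\<lambda>_. P)) {X \<in> space (PiM I (\<lambda>_. P)). s (X i) = s (X j)} =
        (\<integral>\<^sup>+X. indicator {X \<in> space (PiM I (\<lambda>_. P)). s (X i) = s (X j)} X \<partial>PiM I (\<lambda>_. P))"
      by simp
    also have "\<dots> = (\<integral>\<^sup>+X. (if s (X i) = s (X j) then 1 else 0) \<partial>PiM I (\<lambda>_. P))"
      by (intro nn_integral_cong) (simp add: indicator_def)
    also have "\<dots> = (\<integral>\<^sup>+X. (if s (X i) = s (X j) then 1 else 0) \<partial>PiM (insert i (I - {i})) (\<lambda>_. P))"
      using I by simp
    also have "\<dots> = (\<integral>\<^sup>+X. (\<integral>\<^sup>+y. (if s y = s (X j) then 1 else 0) \<partial>P) \<partial>PiM (I - {i}) (\<lambda>_. P))"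
    proof (subst product_nn_integral_insert)
      show "(\<lambda>X. if s (X i) = s (X j) then 1 else 0 :: ennreal)
          \<in> borel_measurable (PiM (insert i (I - {i})) (\<lambda>_. P))"
        using ij by (simp add: I[symmetric])
    qed (use fin ij in auto)
    also have "\<dots> = (\<integral>\<^sup>+X. 0 \<partial>PiM (I - {i}) (\<lambda>_. P))"
    proof (intro nn_integral_cong)
      fix X
      have "(\<integral>\<^sup>+y. (if s y = s (X j) then 1 else 0) \<partial>P) = (\<integral>\<^sup>+y. 0 \<partial>P)"
        using atomless[of "s (X j)"] by (intro nn_integral_cong_AE) (auto elim!: eventually_mono)
      then show "(\<integral>\<^sup>+y. (if s y = s (X j) then 1 else 0) \<partial>P) = 0"
        by simp
    qed
    finally show ?thesis
      by (intro AE_I[of _ _ "{X \<in> space (PiM I (\<lambda>_. P)). s (X i) = s (X j)}"]) auto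
  qed
  have "AE X in PiM I (\<lambda>_. P). \<forall>i\<in>I. \<forall>j\<in>I. i \<noteq> j \<longrightarrow> s (X i) \<noteq> s (X j)"
    using neq assms(2) by (intro AE_finite_allI) (auto intro: AE_impI)
  then show ?thesis
    by eventually_elim (auto simp: inj_on_def)
qed

text \<open>The deterministic estimate \<open>weighted_rank_sum\<close> concerns the sum over all indices. By exchangeability
  its expectation is the number of indices times the contribution of a single one, which produces
  the factor \<open>1 / card I\<close>.\<close>

lemma expected_covered_weight:
  fixes s :: "'a \<Rightarrow> ereal"
  assumes P: "prob_space P" and I: "finite I" "j \<in> I"
    and [measurable]: "w \<in> borel_measurable P" "s \<in> borel_measurable P"
    and w: "\<And>x. 0 \<le> w x" "\<And>x. w x \<le> b"
    and atomless: "\<And>t. AE x in P. s x \<noteq> t"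
    and \<alpha>: "0 \<le> \<alpha>" "\<alpha> \<le> 1"
  shows "\<bar>(\<integral>X. (if covered \<alpha> w s I X j then w (X j) else 0) \<partial>PiM I (\<lambda>_. P)) -
      \<alpha> * (\<integral>x. w x \<partial>P)\<bar> \<le> b / card I"
proof -
  interpret P: prob_space P by fact
  interpret PI: prob_space "PiM I (\<lambda>_. P)"
    using P by (intro prob_space_PiM)
  let ?M = "PiM I (\<lambda>_. P)"
  let ?G = "\<lambda>k X. if covered \<alpha> w s I X k then w (X k) else 0"
  have b: "0 \<le> b"
    using w[of undefined] by linarith
  have [measurable]: "?G k \<in> borel_measurable ?M" "(\<lambda>X. w (X k)) \<in> borel_measurable ?M" if "k \<in> I" for k
    using I that by measurable
  have G_int: "integrable ?M (?G k)" and w_int: "integrable ?M (\<lambda>X. w (X k))" if "k \<in> I" for k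
    using w b that by (intro PI.integrable_const_bound[where B=b]; auto)+
  have G_eq: "(\<integral>X. ?G k X \<partial>?M) = (\<integral>X. ?G j X \<partial>?M)" if k: "k \<in> I" for k
  proof -
    have "(\<integral>X. ?G j X \<partial>?M) = (\<integral>X. ?G j (\<lambda>i\<in>I. X (Transposition.transpose j k i)) \<partial>?M)"
      using I k P by (intro integral_PiM_transpose[symmetric]) auto
    also have "\<dots> = (\<integral>X. ?G k X \<partial>?M)"
      using I k by (intro Bochner_Integration.integral_cong) (auto simp: covered_transpose)
    finally show ?thesis ..
  qed
  have w_eq: "(\<integral>X. w (X k) \<partial>?M) = (\<integral>x. w x \<partial>P)" if k: "k \<in> I" for k
  proof -
    have "(\<integral>x. w x \<partial>distr ?M P (\<lambda>X. X k)) = (\<integral>X. w (X k) \<partial>?M)"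
      using k by (intro integral_distr) auto
    then show ?thesis
      using distr_PiM_component[of I "\<lambda>_. P" k] P k by simp
  qed
  have "AE X in ?M. \<bar>(\<Sum>k\<in>I. ?G k X) - \<alpha> * (\<Sum>k\<in>I. w (X k))\<bar> \<le> b"
    using AE_PiM_inj_on[OF P I(1) _ atomless]
  proof (rule AE_mp, safe intro!: AE_I2)
    fix X assume "inj_on (\<lambda>i. s (X i)) I"
    then have "\<bar>(\<Sum>k | k \<in> I \<and> covered \<alpha> w s I X k. w (X k)) - \<alpha> * (\<Sum>k\<in>I. w (X k))\<bar> \<le> b"
      unfolding covered_def using w b \<alpha> I(1) by (intro weighted_rank_sum) auto
    then show "\<bar>(\<Sum>k\<in>I. ?G k X) - \<alpha> * (\<Sum>k\<in>I. w (X k))\<bar> \<le> b"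
      using I(1) by (simp add: sum.inter_filter)
  qed simp
  then have "(\<integral>X. \<bar>(\<Sum>k\<in>I. ?G k X) - \<alpha> * (\<Sum>k\<in>I. w (X k))\<bar> \<partial>?M) \<le> b"
    using G_int w_int by (intro PI.integral_le_const) auto
  moreover have "\<bar>\<integral>X. (\<Sum>k\<in>I. ?G k X) - \<alpha> * (\<Sum>k\<in>I. w (X k)) \<partial>?M\<bar>
      \<le> (\<integral>X. \<bar>(\<Sum>k\<in>I. ?G k X) - \<alpha> * (\<Sum>k\<in>I. w (X k))\<bar> \<partial>?M)"
    by (rule integral_abs_bound)
  moreover have "(\<integral>X. (\<Sum>k\<in>I. ?G k X) - \<alpha> * (\<Sum>k\<in>I. w (X k)) \<partial>?M) =
      card I * ((\<integral>X. ?G j X \<partial>?M) - \<alpha> * (\<integral>x. w x \<partial>P))"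
    using G_int w_int G_eq w_eq by (simp add: right_diff_distrib)
  ultimately have "card I * \<bar>(\<integral>X. ?G j X \<partial>?M) - \<alpha> * (\<integral>x. w x \<partial>P)\<bar> \<le> b"
    by (simp add: abs_mult)
  moreover have "0 < card I"
    using I by (auto simp: card_gt_0_iff)
  ultimately show ?thesis
    by (simp add: pos_le_divide_eq mult.commute)
qed

section \<open>Passing to the test distribution\<close>

lemma tv_dist_ge:
  assumes "prob_space \<mu>" "prob_space \<nu>" "A \<in> sets \<mu>"
  shows "\<bar>measure \<mu> A - measure \<nu> A\<bar> \<le> tv_dist \<mu> \<nu>"
  unfolding tv_dist_def
proof (rule cSUP_upper[OF assms(3)])
  show "bdd_above ((\<lambda>A. \<bar>measure \<mu> A - measure \<nu> A\<bar>) ` sets \<mu>)"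
  proof (rule bdd_aboveI2)
    fix B
    show "\<bar>measure \<mu> B - measure \<nu> B\<bar> \<le> 1"
      using prob_space.prob_le_1[OF assms(1), of B] prob_space.prob_le_1[OF assms(2), of B]
        measure_nonneg[of \<mu> B] measure_nonneg[of \<nu> B] by linarith
  qed
qed

lemma borel_measurable_measure_Pair:
  assumes "prob_space R" "E \<in> sets (M \<Otimes>\<^sub>M R)"
  shows "(\<lambda>x. measure R (Pair x -` E)) \<in> borel_measurable M"
proof -
  interpret R: prob_space R by fact
  show ?thesis
    using R.measurable_emeasure_Pair[OF assms(2)] unfolding measure_def by measurable
qed

lemma measure_pair_eq_integral:
  assumes "prob_space M" "prob_space R" and E: "E \<in> sets (M \<Otimes>\<^sub>M R)"
  shows "measure (M \<Otimes>\<^sub>M R) E = (\<integral>x. measure R (Pair x -` E) \<partial>M)"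
proof -
  interpret M: prob_space M by fact
  interpret R: prob_space R by fact
  note [measurable] = borel_measurable_measure_Pair[OF assms(2) E]
  have "emeasure (M \<Otimes>\<^sub>M R) E = (\<integral>\<^sup>+x. ennreal (measure R (Pair x -` E)) \<partial>M)"
    by (simp add: R.emeasure_pair_measure_alt[OF E] R.emeasure_eq_measure)
  also have "\<dots> = ennreal (\<integral>x. measure R (Pair x -` E) \<partial>M)"
    by (intro nn_integral_eq_integral M.integrable_const_bound[where B=1]) auto
  finally show ?thesis
    by (simp add: measure_def)
qed

text \<open>The estimate holds for every section of the event and is then integrated over the first factor.\<close>

lemma measure_pair_diff_le_tv_dist:
  assumes M: "prob_space M" and Q: "prob_space Q" and R: "prob_space R"
    and sets: "sets R = sets Q" and E: "E \<in> sets (M \<Otimes>\<^sub>M Q)"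
  shows "\<bar>measure (M \<Otimes>\<^sub>M Q) E - measure (M \<Otimes>\<^sub>M R) E\<bar> \<le> tv_dist Q R"
proof -
  interpret M: prob_space M by fact
  interpret Q: prob_space Q by fact
  interpret R: prob_space R by fact
  have E': "E \<in> sets (M \<Otimes>\<^sub>M R)"
    using E sets_pair_measure_cong[OF refl sets, of M] by simp
  note [measurable] = borel_measurable_measure_Pair[OF Q E] borel_measurable_measure_Pair[OF R E']
  have int: "integrable M (\<lambda>x. measure Q (Pair x -` E))" "integrable M (\<lambda>x. measure R (Pair x -` E))"
    by (intro M.integrable_const_bound[where B=1]; simp)+
  have "\<bar>measure (M \<Otimes>\<^sub>M Q) E - measure (M \<Otimes>\<^sub>M R) E\<bar> =
      \<bar>\<integral>x. measure Q (Pair x -` E) - measure R (Pair x -` E) \<partial>M\<bar>"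
    using int by (simp add: measure_pair_eq_integral M Q R E E')
  also have "\<dots> \<le> (\<integral>x. \<bar>measure Q (Pair x -` E) - measure R (Pair x -` E)\<bar> \<partial>M)"
    by (rule integral_abs_bound)
  also have "\<dots> \<le> tv_dist Q R"
    using int E tv_dist_ge[OF Q R] by (intro M.integral_le_const AE_I2) (auto intro: sets_Pair1)
  finally show ?thesis .
qed

section \<open>Coverage guarantee\<close>

text \<open>Drawing the new point from the reweighted law amounts to drawing all \<open>N + 1\<close> points from \<open>P\<close> and
  weighting the sample by \<open>w (X N) / E w\<close>. This brings coverage under \<open>expected_covered_weight\<close> with the
  new point at index \<open>N\<close>.\<close>

lemma reweighted_coverage:
  fixes f h :: "real ^ 'd \<Rightarrow> real ^ 'n"
  assumes P: "prob_space P" "sets P = sets borel"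
    and atomless: "\<And>t. AE x in P. score f h x \<noteq> ereal t"
    and f: "f \<in> borel_measurable borel" and h: "h \<in> borel_measurable borel"
    and w: "w \<in> borel_measurable borel" "\<And>x. a \<le> w x" "\<And>x. w x \<le> b" "0 < a"
    and \<alpha>: "0 < \<alpha>" "\<alpha> < 1"
    and ex: "AE D in PiM {..<N} (\<lambda>_. P). minimal_scale_exists \<alpha> w f h N D"
  defines "R \<equiv> density P (\<lambda>x. ennreal (w x / (\<integral>y. w y \<partial>P)))"
  shows "prob_space R"
    and "\<bar>measure (PiM {..<N} (\<lambda>_. P) \<Otimes>\<^sub>M R) {\<omega> \<in> space (PiM {..<N} (\<lambda>_. P) \<Otimes>\<^sub>M R).
           fst (snd \<omega>) \<in> oodro_set \<alpha> w f h N (fst \<omega>) (snd (snd \<omega>))} - \<alpha>\<bar>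
         \<le> 1 / (real N + 1) * (b / a)"
proof -
  interpret P: prob_space P by fact
  interpret product_sigma_finite "\<lambda>_. P" by standard
  let ?PN = "PiM {..<N} (\<lambda>_. P)" and ?s = "score f h"
  interpret PN: prob_space ?PN
    using P by (intro prob_space_PiM)
  interpret PN1: prob_space "PiM {..<Suc N} (\<lambda>_. P)"
    using P by (intro prob_space_PiM)
  define W where "W = (\<integral>y. w y \<partial>P)"
  have w_pos: "0 < w x" for x
    using w(2)[of x] w(4) by linarith
  have [measurable]: "w \<in> borel_measurable P" "?s \<in> borel_measurable P"
    using w(1) borel_measurable_score[OF f h] measurable_cong_sets[OF P(2) refl] by auto
  have w_int: "integrable P w"
    using w w_pos by (intro P.integrable_const_bound[where B=b]) (auto simp: less_imp_le)
  have W: "a \<le> W"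
    unfolding W_def using w(2) w_int by (intro P.integral_ge_const) auto
  then have W_pos: "0 < W"
    using w(4) by simp
  have R: "R = density P (\<lambda>x. ennreal (w x / W))"
    by (simp add: R_def W_def)
  have sets_R: "sets R = sets borel" "space R = space P"
    by (simp_all add: R P(2))
  show prob_R: "prob_space R"
  proof
    have "emeasure R (space R) = (\<integral>\<^sup>+x. ennreal (w x / W) \<partial>P)"
      by (simp add: R emeasure_density cong: nn_integral_cong)
    also have "\<dots> = ennreal (\<integral>x. w x / W \<partial>P)"
      using w_int w_pos W_pos by (intro nn_integral_eq_integral) (auto simp: less_imp_le)
    also have "\<dots> = 1"
      using W_pos by (simp add: W_def)
    finally show "emeasure R (space R) = 1" .
  qed
  define E where "E = {\<omega> \<in> space (?PN \<Otimes>\<^sub>M R). fst (snd \<omega>) \<in> oodro_set \<alpha> w f h N (fst \<omega>) (snd (snd \<omega>))}"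
  have E: "E \<in> sets (?PN \<Otimes>\<^sub>M R)"
    unfolding E_def using w_pos w(1) f h P(2) sets_R(1)
    by (intro measurable_oodro_coverage) (auto simp: less_imp_le)
  \<comment> \<open>The covered weight of the new point; divided by \<open>W\<close> it is the coverage indicator tilted to \<open>R\<close>.\<close>
  define G where "G X = (if covered \<alpha> w ?s {..<Suc N} X N then w (X N) else 0)" for X
  have G_meas: "G \<in> borel_measurable (PiM {..<Suc N} (\<lambda>_. P))"
    unfolding G_def by measurable
  have infty: "AE x in P. ?s x \<noteq> \<infinity>"
    using P(1) \<alpha>(1) ex by (intro AE_score_finite) auto
  have atomless': "AE x in P. ?s x \<noteq> t" for t
  proof (cases t)
    case MInf
    then show ?thesis using score_nonneg[of f h] by (intro AE_I2) (metis ereal_infty_less_eq2(2) MInfty_neq_ereal(2) zero_ereal_def)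
  qed (use infty atomless in auto)
  have "measure R (Pair D -` E) = (\<integral>x. G (D(N := x)) \<partial>P) / W"
    if D: "D \<in> space ?PN" "minimal_scale_exists \<alpha> w f h N D" for D
  proof -
    have ED [measurable]: "Pair D -` E \<in> sets P"
      using sets_Pair1[OF E, of D] by (simp add: R)
    have "measure R (Pair D -` E) = (\<integral>x. indicator (Pair D -` E) x \<partial>R)"
      using ED by (simp add: R)
    also have "\<dots> = (\<integral>x. (w x / W) * indicator (Pair D -` E) x \<partial>P)"
      unfolding R using w_pos W_pos by (subst integral_density) (auto simp: less_imp_le)
    also have "\<dots> = (\<integral>x. G (D(N := x)) / W \<partial>P)"
    proof (rule integral_cong_AE)
      have "(\<lambda>x. D(N := x)) \<in> P \<rightarrow>\<^sub>M PiM (insert N {..<N}) (\<lambda>_. P)"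
        using D(1) by measurable
      from measurable_compose[OF this, of G borel] show "(\<lambda>x. G (D(N := x)) / W) \<in> borel_measurable P"
        using G_meas by (simp add: lessThan_Suc)
      show "AE x in P. (w x / W) * indicator (Pair D -` E) x = G (D(N := x)) / W"
        using atomless'[of 0] AE_space
      proof eventually_elim
        fix x assume "?s x \<noteq> 0" and x: "x \<in> space P"
        then have "0 < ?s x"
          using score_nonneg[of f h x] by (simp add: less_le)
        then have "fst x \<in> oodro_set \<alpha> w f h N D (snd x) \<longleftrightarrow> covered \<alpha> w ?s {..<Suc N} (D(N := x)) N"
          by (intro oodro_set_iff_covered w_pos D(2) \<alpha>(1))
        then show "(w x / W) * indicator (Pair D -` E) x = G (D(N := x)) / W"
          using D(1) x by (simp add: E_def G_def indicator_def space_pair_measure sets_R(2))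
      qed
    qed measurable
    finally show ?thesis
      by simp
  qed
  then have slice: "AE D in ?PN. measure R (Pair D -` E) = (\<integral>x. G (D(N := x)) \<partial>P) / W"
    using ex AE_space by (auto elim: eventually_elim2)
  have G_int: "integrable (PiM {..<Suc N} (\<lambda>_. P)) G"
    using G_meas w(3) w_pos order_trans[OF less_imp_le[OF w_pos] w(3)]
    by (intro PN1.integrable_const_bound[where B=b]) (auto simp: G_def less_imp_le)
  have fubini: "(\<integral>X. G X \<partial>PiM {..<Suc N} (\<lambda>_. P)) = (\<integral>D. (\<integral>x. G (D(N := x)) \<partial>P) \<partial>?PN)"
    using product_integral_insert[of "{..<N}" N G] G_int by (simp add: lessThan_Suc)
  have "measure (?PN \<Otimes>\<^sub>M R) E = (\<integral>D. measure R (Pair D -` E) \<partial>?PN)"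
    using PN.prob_space_axioms prob_R E by (rule measure_pair_eq_integral)
  also have "\<dots> = (\<integral>D. (\<integral>x. G (D(N := x)) \<partial>P) / W \<partial>?PN)"
  proof (rule integral_cong_AE[OF _ _ slice])
    show "(\<lambda>D. measure R (Pair D -` E)) \<in> borel_measurable ?PN"
      using prob_R E by (rule borel_measurable_measure_Pair)
    have "(\<lambda>(D, x). D(N := x)) \<in> ?PN \<Otimes>\<^sub>M P \<rightarrow>\<^sub>M PiM {..<Suc N} (\<lambda>_. P)"
      using measurable_add_dim[of N "{..<N}" "\<lambda>_. P"] by (simp add: lessThan_Suc)
    from measurable_compose[OF this G_meas]
    have "(\<lambda>(D, x). G (D(N := x))) \<in> borel_measurable (?PN \<Otimes>\<^sub>M P)"
      by (simp add: case_prod_beta')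
    then show "(\<lambda>D. (\<integral>x. G (D(N := x)) \<partial>P) / W) \<in> borel_measurable ?PN"
      by (intro borel_measurable_divide P.borel_measurable_lebesgue_integral) auto
  qed
  also have "\<dots> = (\<integral>X. G X \<partial>PiM {..<Suc N} (\<lambda>_. P)) / W"
    by (simp add: fubini)
  finally have meas: "measure (?PN \<Otimes>\<^sub>M R) E = (\<integral>X. G X \<partial>PiM {..<Suc N} (\<lambda>_. P)) / W" .
  have "\<bar>(\<integral>X. G X \<partial>PiM {..<Suc N} (\<lambda>_. P)) - \<alpha> * W\<bar> \<le> b / card {..<Suc N}"
    unfolding G_def W_def using P(1) w(3) w_pos atomless' \<alpha>
    by (intro expected_covered_weight) (auto simp: less_imp_le)
  then have "\<bar>(\<integral>X. G X \<partial>PiM {..<Suc N} (\<lambda>_. P)) - \<alpha> * W\<bar> / W \<le> b / (real N + 1) / W"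
    using W_pos by (intro divide_right_mono) (auto simp: add.commute)
  also have "\<dots> \<le> b / (real N + 1) / a"
    using W w(4) order_trans[OF less_imp_le[OF w_pos] w(3)] by (intro divide_left_mono) auto
  also have "\<bar>(\<integral>X. G X \<partial>PiM {..<Suc N} (\<lambda>_. P)) - \<alpha> * W\<bar> / W = \<bar>measure (?PN \<Otimes>\<^sub>M R) E - \<alpha>\<bar>"
  proof -
    have "\<bar>(\<integral>X. G X \<partial>PiM {..<Suc N} (\<lambda>_. P)) - \<alpha> * W\<bar> / W =
        \<bar>((\<integral>X. G X \<partial>PiM {..<Suc N} (\<lambda>_. P)) - \<alpha> * W) / W\<bar>"
      using W_pos by simp
    then show ?thesis
      using W_pos by (simp add: meas diff_divide_distrib)
  qed
  finally show "\<bar>measure (?PN \<Otimes>\<^sub>M R) {\<omega> \<in> space (?PN \<Otimes>\<^sub>M R).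
      fst (snd \<omega>) \<in> oodro_set \<alpha> w f h N (fst \<omega>) (snd (snd \<omega>))} - \<alpha>\<bar> \<le> 1 / (real N + 1) * (b / a)"
    by (simp add: E_def)
qed

lemma reweighted_eq_density:
  assumes [measurable]: "p \<in> borel_measurable borel" "w \<in> borel_measurable borel"
    and nn: "\<And>x. 0 \<le> p x" "\<And>x. 0 \<le> w x"
  shows "reweighted w p = density (density lborel (\<lambda>x. ennreal (p x)))
      (\<lambda>x. ennreal (w x / (\<integral>y. w y \<partial>density lborel (\<lambda>x. ennreal (p x)))))"
proof -
  have W: "(\<integral>y. w y \<partial>density lborel (\<lambda>x. ennreal (p x))) = (\<integral>y. w y * p y \<partial>lborel)"
    using nn by (subst integral_density) (auto simp: mult.commute)
  have "0 \<le> (\<integral>y. w y * p y \<partial>lborel)"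
    using nn by (intro integral_nonneg_AE) auto
  then show ?thesis
    using nn unfolding reweighted_def W
    by (subst density_density_eq) (auto intro!: arg_cong[of _ _ "density lborel"] simp: ennreal_mult'[symmetric] mult.commute)
qed

theorem corollary1:
  fixes P Q :: "((real ^ 'n) \<times> (real ^ 'd)) measure"
    and p q w_hat :: "(real ^ 'n) \<times> (real ^ 'd) \<Rightarrow> real"
    and f_hat h_hat :: "real ^ 'd \<Rightarrow> real ^ 'n"
    and H :: "(real ^ 'd \<Rightarrow> real ^ 'n) set"
    and D1 :: "nat \<Rightarrow> (real ^ 'n) \<times> (real ^ 'd)"
    and N1 N2 :: nat
    and \<alpha> w_lo w_hi :: real
  assumes "p \<in> borel_measurable borel" and "\<And>x. 0 \<le> p x"
    and "q \<in> borel_measurable borel" and "\<And>x. 0 \<le> q x"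
    and "P = density lborel (\<lambda>x. ennreal (p x))" and "prob_space P"
    and "Q = density lborel (\<lambda>x. ennreal (q x))" and "prob_space Q"
    and "\<And>x. p x = 0 \<Longrightarrow> q x = 0"
    and "0 < \<alpha>" and "\<alpha> < 1"
    and "f_hat \<in> borel_measurable borel"
    and "h_hat \<in> borel_measurable borel"
    and "w_hat \<in> borel_measurable borel"
    and "quantile_regression \<alpha> f_hat N1 D1 H h_hat"
    and "0 < w_lo" and "0 < w_hi"
    and "\<And>c z. w_lo \<le> w_hat (c, z) \<and> w_hat (c, z) \<le> w_hi"
    and "AE D2 in PiM {..<N2} (\<lambda>_. P). minimal_scale_exists \<alpha> w_hat f_hat h_hat N2 D2"
  shows "\<bar>\<P>(\<omega> in PiM {..<N2} (\<lambda>_. P) \<Otimes>\<^sub>M Q.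
            case \<omega> of (D2, (c_new, z_new)) \<Rightarrow>
              c_new \<in> oodro_set \<alpha> w_hat f_hat h_hat N2 D2 z_new) - \<alpha>\<bar>
         \<le> 1 / (real N2 + 1) * (w_hi / w_lo) + tv_dist Q (reweighted w_hat p)"
proof -
  let ?PN = "PiM {..<N2} (\<lambda>_. P)" and ?R = "reweighted w_hat p"
  let ?E = "\<lambda>M. {\<omega> \<in> space (?PN \<Otimes>\<^sub>M M).
      fst (snd \<omega>) \<in> oodro_set \<alpha> w_hat f_hat h_hat N2 (fst \<omega>) (snd (snd \<omega>))}"
  have w: "w_lo \<le> w_hat x" "w_hat x \<le> w_hi" "0 \<le> w_hat x" for x
    using assms(16) assms(18)[of "fst x" "snd x"] by auto
  have R: "?R = density P (\<lambda>x. ennreal (w_hat x / (\<integral>y. w_hat y \<partial>P)))"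
    using reweighted_eq_density[of p w_hat] assms(1,2,5,14) w(3) by simp
  have sets: "sets P = sets borel" "sets Q = sets borel" "sets ?R = sets Q"
    by (simp_all add: assms(5,7) reweighted_def)
  have atomless: "AE x in P. score f_hat h_hat x \<noteq> ereal t" for t
  proof -
    have "AE x in density lborel (\<lambda>x. ennreal (p x)). score f_hat h_hat x \<noteq> ereal t"
      using AE_lborel_score_neq[OF assms(12,13), of t] assms(1)
      by (subst AE_density) (auto elim: eventually_mono)
    then show ?thesis
      by (simp only: assms(5))
  qed
  have prob_R: "prob_space ?R"
    and cov: "\<bar>measure (?PN \<Otimes>\<^sub>M ?R) (?E ?R) - \<alpha>\<bar> \<le> 1 / (real N2 + 1) * (w_hi / w_lo)"
    unfolding R
    using reweighted_coverage[OF assms(6) sets(1) atomless assms(12-14) w(1,2) assms(16,10,11,19)]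
    by auto
  have E_eq: "?E ?R = ?E Q"
    using sets_eq_imp_space_eq[OF sets(3)] by (simp add: space_pair_measure)
  have "\<bar>measure (?PN \<Otimes>\<^sub>M Q) (?E Q) - measure (?PN \<Otimes>\<^sub>M ?R) (?E Q)\<bar> \<le> tv_dist Q ?R"
    using assms(6,8,12-14) sets prob_R w(3)
    by (intro measure_pair_diff_le_tv_dist measurable_oodro_coverage prob_space_PiM) auto
  then have "\<bar>measure (?PN \<Otimes>\<^sub>M Q) (?E Q) - \<alpha>\<bar> \<le>
      1 / (real N2 + 1) * (w_hi / w_lo) + tv_dist Q ?R"
    using cov unfolding E_eq by linarith
  then show ?thesis
    by (simp add: case_prod_beta)
qed

end
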